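(* Let $\mathcal{B}$ and $\mathcal{B}'$ be a pair of RKBSs on $X$ and $X'$ respectively, let $K:X\times X'\to\mathbb{R}$ be the reproducing kernel for $\mathcal{B}$, let $\mathcal{B}_*$ be a pre-dual space of $\mathcal{B}$, and let $\nu_1,\dots,\nu_n\in\mathcal{B}_*$ be linearly independent. Let $\mathbf{y}\in\mathbb{R}^n\setminus\{\mathbf{0}\}$, let $\mathcal{V}:=\mathrm{span}\{\nu_1,\dots,\nu_n\}$ and $\mathcal{M}_{\mathbf{y}}:=\{f\in\mathcal{B}:\langle\nu_j,f\rangle_{\mathcal{B}}=y_j,\ j=1,\dots,n\}$, and let $\mathrm{S}(\mathbf{y})$ be the set of all $f\in\mathcal{M}_{\mathbf{y}}$ with $\|f\|_{\mathcal{B}}=\inf\{\|h\|_{\mathcal{B}}:h\in\mathcal{M}_{\mathbf{y}}\}$. Let $\hat\nu\in\mathcal{V}$ satisfy $$\bigl(\|\hat\nu\|_{\mathcal{B}_*}\,\partial\|\cdot\|_{\mathcal{B}_*}(\hat\nu)\bigr)\cap\mathcal{M}_{\mathbf{y}}\neq\emptyset .$$ Suppose that Assumption (A1) holds, and that Assumption (A2) holds with a positive constant $C$. Then for every $\hat f\in\mathrm{ext}(\mathrm{S}(\mathbf{y}))$ there exist a positive integer $M\le\mathrm{rank}(\mathbf{L}_{\hat\nu})$, real numbers $\hat\alpha_j\neq0$, $j=1,\dots,M$, with $\sum_{j=1}^M|\hat\alpha_j|=\|\hat\nu\|_{\mathcal{B}_*}/C$, and points $x_j'\in X'_{\hat\nu}$,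 $j=1,\dots,M$, such that $$\hat f=\sum_{j=1}^M\hat\alpha_jK(\cdot,x_j').$$
   Context: All spaces are real. A Banach space of functions on a set $X$ is a Banach space whose elements are functions on $X$ such that $\|f\|=0$ implies $f(x)=0$ for all $x\in X$. It is an RKBS (reproducing kernel Banach space) on $X$ if every point evaluation $\delta_x$, $x\in X$, is continuous. The $\delta$-dual space $\mathcal{B}'$ of an RKBS $\mathcal{B}$ is the norm closure of $\mathrm{span}\{\delta_x:x\in X\}$ in $\mathcal{B}^*$; it is assumed isometrically isomorphic to a Banach space of functions on a set $X'$ and is identified with that space. The reproducing kernel for $\mathcal{B}$ is the unique function $K:X\times X'\to\mathbb{R}$ with $K(x,\cdot)\in\mathcal{B}'$ and $f(x)=\langle K(x,\cdot),f\rangle_{\mathcal{B}}$ for all $x\in X$, $f\in\mathcal{B}$. If moreover $\mathcal{B}'$ is an RKBS on $X'$, $K(\cdot,x')\in\mathcal{B}$ for all $x'\in X'$, and $g(x')=\langle g,K(\cdot,x')\rangle_{\mathcal{B}}$ for all $g\in\mathcal{B}'$, $x'\in X'$, then $\mathcal{B}'$ is called an adjoint RKBS of $\mathcal{B}$, and $\mathcal{B},\mathcal{B}'$ a pair of RKBSs. A pre-dual space of $\mathcal{B}$ is a Banach space $\mathcal{B}_*$ with $(\mathcal{B}_* )^*=\mathcal{B}$ (isometric identification); elements of $\mathcal{B}_*$ act on $\mathcal{B}$ by $\langle\nu,f\rangle_{\mathcal{B}}=\langle f,\nu\rangle_{\mathcal{B}_*}$. $\partial\|\cdot\|_{\mathcal{B}_*}(\nu)\subset\mathcal{B}$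 is the subdifferential of the norm of $\mathcal{B}_*$ at $\nu$; $\mathrm{ext}(A)$ is the set of extreme points of a convex set $A$. Assumption (A1): for every nonzero $\nu\in\mathcal{V}$ there exists a finite subset $X'_\nu$ of $X'$ (fixed once and for all) such that $\mathrm{ext}(\partial\|\cdot\|_{\mathcal{B}_*}(\nu))\subset\{-K(\cdot,x'),K(\cdot,x'):x'\in X'_\nu\}$. Assumption (A2): there is a constant $C>0$ such that for all $m\in\mathbb{N}$, all distinct $x_1',\dots,x_m'\in X'$ and all $\boldsymbol{\alpha}\in\mathbb{R}^m$, $\bigl\|\sum_{j=1}^m\alpha_jK(\cdot,x_j')\bigr\|_{\mathcal{B}}=C\|\boldsymbol{\alpha}\|_1$. For nonzero $\nu\in\mathcal{V}$, let $n(\nu)$ be the cardinality of $X'_\nu$, enumerate $X'_\nu=\{t_1',\dots,t_{n(\nu)}'\}$, and set $\mathbf{L}_\nu:=[\langle\nu_i,K(\cdot,t_j')\rangle_{\mathcal{B}}]_{1\le i\le n,\,1\le j\le n(\nu)}\in\mathbb{R}^{n\times n(\nu)}$. (The hypothesis on $\hat\nu$ together with $\mathbf{y}\ne\mathbf{0}$ forces $\hat\nu\neq0$.) *)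

theory Defs
  imports "HOL-Analysis.Analysis" "Jordan_Normal_Form.DL_Rank"
begin

text \<open>
  A Banach space of functions on the set of all elements of type \<open>'x\<close> is a Banach space \<open>'b\<close>
  together with an evaluation map \<open>ev\<close>, where \<open>ev f x\<close> is the value \<open>f(x)\<close>. Injectivity of
  \<open>ev\<close> says that the elements of the space are functions; together with linearity it
  includes the requirement that norm zero implies vanishing at every point.
\<close>

definition banach_function_space :: "('b::banach \<Rightarrow> 'x \<Rightarrow> real) \<Rightarrow> bool" where
  "banach_function_space ev \<longleftrightarrow> (\<forall>x. linear (\<lambda>f. ev f x)) \<and> inj ev"

definition rkbs :: "('b::banach \<Rightarrow> 'x \<Rightarrow> real) \<Rightarrow> bool" where
  "rkbs ev \<longleftrightarrow> banach_function_space ev \<and> (\<forall>x. continuous_on UNIV (\<lambda>f. ev f x))"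

definition point_evaluation :: "('b::banach \<Rightarrow> 'x \<Rightarrow> real) \<Rightarrow> 'x \<Rightarrow> 'b \<Rightarrow>\<^sub>L real" where
  "point_evaluation ev x = Blinfun (\<lambda>f. ev f x)"

definition delta_dual :: "('b::banach \<Rightarrow> 'x \<Rightarrow> real) \<Rightarrow> ('b \<Rightarrow>\<^sub>L real) set" where
  "delta_dual ev = closure (span (range (point_evaluation ev)))"

definition isometric_iso_onto ::
    "('a::real_normed_vector \<Rightarrow> 'b::real_normed_vector) \<Rightarrow> 'b set \<Rightarrow> bool" where
  "isometric_iso_onto J S \<longleftrightarrow> linear J \<and> (\<forall>g. norm (J g) = norm g) \<and> range J = S"

text \<open>
  The space \<open>'d\<close> of functions on \<open>'y\<close>, with evaluation \<open>ev'\<close>, is identified with the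
  delta-dual space through \<open>J\<close>. The dual pairing of \<open>g\<close> and \<open>f\<close> is then \<open>blinfun_apply (J g) f\<close>.
\<close>

definition delta_dual_space ::
    "('b::banach \<Rightarrow> 'x \<Rightarrow> real) \<Rightarrow> ('d::banach \<Rightarrow> 'y \<Rightarrow> real) \<Rightarrow> ('d \<Rightarrow> 'b \<Rightarrow>\<^sub>L real) \<Rightarrow> bool" where
  "delta_dual_space ev ev' J \<longleftrightarrow>
     banach_function_space ev' \<and> isometric_iso_onto J (delta_dual ev)"

definition reproducing_kernel ::
    "('b::banach \<Rightarrow> 'x \<Rightarrow> real) \<Rightarrow> ('d::banach \<Rightarrow> 'y \<Rightarrow> real) \<Rightarrow> ('d \<Rightarrow> 'b \<Rightarrow>\<^sub>L real)
      \<Rightarrow> ('x \<Rightarrow> 'y \<Rightarrow> real) \<Rightarrow> bool" where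
  "reproducing_kernel ev ev' J K \<longleftrightarrow>
     (\<forall>x. \<exists>g. ev' g = K x \<and> (\<forall>f. ev f x = blinfun_apply (J g) f))"

definition adjoint_rkbs ::
    "('b::banach \<Rightarrow> 'x \<Rightarrow> real) \<Rightarrow> ('d::banach \<Rightarrow> 'y \<Rightarrow> real) \<Rightarrow> ('d \<Rightarrow> 'b \<Rightarrow>\<^sub>L real)
      \<Rightarrow> ('x \<Rightarrow> 'y \<Rightarrow> real) \<Rightarrow> bool" where
  "adjoint_rkbs ev ev' J K \<longleftrightarrow>
     rkbs ev' \<and>
     (\<forall>x'. \<exists>k. ev k = (\<lambda>x. K x x') \<and> (\<forall>g. ev' g x' = blinfun_apply (J g) k))"

definition rkbs_pair ::
    "('b::banach \<Rightarrow> 'x \<Rightarrow> real) \<Rightarrow> ('d::banach \<Rightarrow> 'y \<Rightarrow> real) \<Rightarrow> ('d \<Rightarrow> 'b \<Rightarrow>\<^sub>L real)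
      \<Rightarrow> ('x \<Rightarrow> 'y \<Rightarrow> real) \<Rightarrow> bool" where
  "rkbs_pair ev ev' J K \<longleftrightarrow>
     rkbs ev \<and> delta_dual_space ev ev' J \<and> reproducing_kernel ev ev' J K \<and>
     adjoint_rkbs ev ev' J K"

text \<open>
  The element of \<open>'b\<close> that is the function \<open>\<lambda>x. K x x'\<close>; it exists and is unique for a pair
  of RKBSs.
\<close>

definition kernel_section ::
    "('b::banach \<Rightarrow> 'x \<Rightarrow> real) \<Rightarrow> ('x \<Rightarrow> 'y \<Rightarrow> real) \<Rightarrow> 'y \<Rightarrow> 'b" where
  "kernel_section ev K x' = the_inv ev (\<lambda>x. K x x')"

text \<open>
  The pre-dual space is a Banach space \<open>'p\<close> whose dual is identified with \<open>'b\<close> through \<open>P\<close>;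
  the pairing of \<open>\<nu>\<close> in \<open>'p\<close> with \<open>f\<close> in \<open>'b\<close> is \<open>blinfun_apply (P f) \<nu>\<close>.
\<close>

definition predual :: "('b::banach \<Rightarrow> 'p::banach \<Rightarrow>\<^sub>L real) \<Rightarrow> bool" where
  "predual P \<longleftrightarrow> isometric_iso_onto P UNIV"

definition subdifferential ::
    "('a::real_normed_vector \<Rightarrow> real) \<Rightarrow> 'a \<Rightarrow> ('a \<Rightarrow>\<^sub>L real) set" where
  "subdifferential \<phi> \<nu> = {l. \<forall>\<mu>. \<phi> \<mu> - \<phi> \<nu> \<ge> blinfun_apply l (\<mu> - \<nu>)}"

definition norm_subdifferential ::
    "('b::banach \<Rightarrow> 'p::banach \<Rightarrow>\<^sub>L real) \<Rightarrow> 'p \<Rightarrow> 'b set" where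
  "norm_subdifferential P \<nu> = {f. P f \<in> subdifferential norm \<nu>}"

definition extreme_points :: "'a::real_vector set \<Rightarrow> 'a set" where
  "extreme_points S = {x. x extreme_point_of S}"

text \<open>Families indexed by \<open>1, \<dots>, n\<close> are indexed here by \<open>0, \<dots>, n - 1\<close>.\<close>

definition interpolants ::
    "('b::banach \<Rightarrow> 'p::banach \<Rightarrow>\<^sub>L real) \<Rightarrow> nat \<Rightarrow> (nat \<Rightarrow> 'p) \<Rightarrow> (nat \<Rightarrow> real) \<Rightarrow> 'b set" where
  "interpolants P n \<nu> y = {f. \<forall>j<n. blinfun_apply (P f) (\<nu> j) = y j}"

definition min_norm_interpolants ::
    "('b::banach \<Rightarrow> 'p::banach \<Rightarrow>\<^sub>L real) \<Rightarrow> nat \<Rightarrow> (nat \<Rightarrow> 'p) \<Rightarrow> (nat \<Rightarrow> real) \<Rightarrow> 'b set" where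
  "min_norm_interpolants P n \<nu> y =
     {f \<in> interpolants P n \<nu> y. norm f = (INF h\<in>interpolants P n \<nu> y. norm h)}"

text \<open>\<open>X\<^sub>f \<mu>\<close> is the finite subset of \<open>'y\<close> chosen for the nonzero element \<open>\<mu>\<close> of the span.\<close>

definition assumption_A1 ::
    "('b::banach \<Rightarrow> 'x \<Rightarrow> real) \<Rightarrow> ('x \<Rightarrow> 'y \<Rightarrow> real) \<Rightarrow> ('b \<Rightarrow> 'p::banach \<Rightarrow>\<^sub>L real)
      \<Rightarrow> 'p set \<Rightarrow> ('p \<Rightarrow> 'y set) \<Rightarrow> bool" where
  "assumption_A1 ev K P V X\<^sub>f \<longleftrightarrow>
     (\<forall>\<mu>\<in>V. \<mu> \<noteq> 0 \<longrightarrow> finite (X\<^sub>f \<mu>) \<and>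
        extreme_points (norm_subdifferential P \<mu>) \<subseteq>
          (\<lambda>x'. - kernel_section ev K x') ` X\<^sub>f \<mu> \<union> kernel_section ev K ` X\<^sub>f \<mu>)"

definition assumption_A2 ::
    "('b::banach \<Rightarrow> 'x \<Rightarrow> real) \<Rightarrow> ('x \<Rightarrow> 'y \<Rightarrow> real) \<Rightarrow> real \<Rightarrow> bool" where
  "assumption_A2 ev K C \<longleftrightarrow>
     (\<forall>(m::nat) x' \<alpha>. inj_on x' {..<m} \<longrightarrow>
        norm (\<Sum>j<m. \<alpha> j *\<^sub>R kernel_section ev K (x' j)) = C * (\<Sum>j<m. \<bar>\<alpha> j\<bar>))"

definition L_matrix ::
    "('b::banach \<Rightarrow> 'x \<Rightarrow> real) \<Rightarrow> ('x \<Rightarrow> 'y \<Rightarrow> real) \<Rightarrow> ('b \<Rightarrow> 'p::banach \<Rightarrow>\<^sub>L real)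
      \<Rightarrow> nat \<Rightarrow> (nat \<Rightarrow> 'p) \<Rightarrow> nat \<Rightarrow> (nat \<Rightarrow> 'y) \<Rightarrow> real mat" where
  "L_matrix ev K P n \<nu> m t =
     Matrix.mat n m (\<lambda>(i, j). blinfun_apply (P (kernel_section ev K (t j))) (\<nu> i))"

end

theory Submission
  imports Defs
begin

text \<open>
  Write \<open>F\<close> for the subdifferential of the predual norm at the dual certificate. It consists of the
  elements of the unit ball of \<open>'b\<close> whose pairing with the certificate is the norm of the
  certificate, so it is convex, closed and bounded.

  Duality identifies the minimum norm interpolants with a slice: they are those elements of \<open>F\<close>,
  scaled by the norm of the certificate, that satisfy the \<open>n\<close> interpolation conditions
  (\<open>min_norm_interpolants_eq\<close>). An extreme point of a slice of a closed bounded convex set by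
  finitely many functionals is a convex combination of extreme points of the set
  (\<open>extreme_point_of_finite_slice_in_hull\<close>, after Dubins); the reason is that around such a point
  the set extends in at most as many independent directions as there are functionals. Since the
  extreme points of \<open>F\<close> are kernel sections up to sign, an extreme solution is a linear
  combination of the kernel sections at the chosen finite set.

  By the second assumption the norm of such a combination is \<open>C\<close> times the \<open>\<ell>\<^sup>1\<close> norm of its
  coefficients, and the norm of every solution is that of the certificate; this gives the sum of
  the absolute coefficients. Finally, suppose that a nontrivial relation holds between the columns
  of the matrix \<open>L\<close> that belong to nonzero coefficients. Moving the coefficients a little in its
  direction, forwards or backwards, reverses no sign and keeps all interpolation conditions. The
  two norms average to the minimal one, so both moves give solutions, and the solution was not
  extreme (\<open>extreme_min_norm_support_independent\<close>). Hence these columns are independent, and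
  their number is at most the rank.
\<close>

section \<open>Extreme points of slices\<close>

lemma extreme_point_of_no_segment:
  fixes x d :: "'a::real_vector"
  assumes "x extreme_point_of S" "x + d \<in> S" "x - d \<in> S"
  shows "d = 0"
proof (rule ccontr)
  assume "d \<noteq> 0"
  have "(1/2) *\<^sub>R (x + d) + (1/2) *\<^sub>R (x - d) = x"
    by (simp add: algebra_simps flip: scaleR_add_left)
  moreover have "x + d \<noteq> x - d"
  proof
    assume "x + d = x - d"
    then have "2 *\<^sub>R d = 0" by (simp add: scaleR_2 algebra_simps eq_diff_eq)
    with \<open>d \<noteq> 0\<close> show False by simp
  qed
  ultimately have "x \<in> open_segment (x + d) (x - d)"
    unfolding in_segment by (intro conjI exI[of _ "1/2"]) auto
  with assms show False
    by (auto simp: extreme_point_of_def)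
qed

lemma extreme_point_ofI_no_segment:
  fixes x :: "'a::real_vector"
  assumes "convex S" "x \<in> S" and no_segment: "\<And>d. x + d \<in> S \<Longrightarrow> x - d \<in> S \<Longrightarrow> d = 0"
  shows "x extreme_point_of S"
  unfolding extreme_point_of_def
proof (intro conjI ballI notI)
  fix a b assume ab: "a \<in> S" "b \<in> S" and "x \<in> open_segment a b"
  then obtain u where u: "0 < u" "u < 1" "a \<noteq> b" and x: "x = (1 - u) *\<^sub>R a + u *\<^sub>R b"
    by (auto simp: in_segment)
  define e where "e = min u (1 - u)"
  have e: "0 < e" "e \<le> u" "e \<le> 1 - u" using u by (auto simp: e_def)
  have "x + e *\<^sub>R (b - a) = (1 - (u + e)) *\<^sub>R a + (u + e) *\<^sub>R b"
    by (simp add: x algebra_simps)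
  also have "\<dots> \<in> S" using ab e u \<open>convex S\<close> by (intro convexD) auto
  finally have 1: "x + e *\<^sub>R (b - a) \<in> S" .
  have "x - e *\<^sub>R (b - a) = (1 - (u - e)) *\<^sub>R a + (u - e) *\<^sub>R b"
    by (simp add: x algebra_simps)
  also have "\<dots> \<in> S" using ab e u \<open>convex S\<close> by (intro convexD) auto
  finally have "x - e *\<^sub>R (b - a) \<in> S" .
  from no_segment[OF 1 this] e u show False by simp
qed fact

lemma extreme_point_of_linear_imageD:
  assumes "linear f" "inj f" "f x extreme_point_of f ` S"
  shows "x extreme_point_of S"
  unfolding extreme_point_of_def
proof (intro conjI ballI)
  show "x \<in> S" using assms by (auto simp: extreme_point_of_def inj_image_mem_iff)
  fix a b assume "a \<in> S" "b \<in> S"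
  then have "f x \<notin> open_segment (f a) (f b)"
    using assms(3) by (auto simp: extreme_point_of_def)
  then show "x \<notin> open_segment a b"
    unfolding open_segment_linear_image[OF assms(1,2)] by blast
qed

lemma last_point_of_ray:
  fixes x d :: "'a::real_normed_vector"
  assumes "closed S" "bounded S" "x \<in> S" "d \<noteq> 0"
  obtains s where "0 \<le> s" "x + s *\<^sub>R d \<in> S" "\<And>r. x + r *\<^sub>R d \<in> S \<Longrightarrow> r \<le> s"
proof -
  define T where "T = {r. 0 \<le> r \<and> x + r *\<^sub>R d \<in> S}"
  obtain B where B: "\<And>z. z \<in> S \<Longrightarrow> norm z \<le> B"
    using \<open>bounded S\<close> by (auto simp: bounded_iff)
  have "r \<le> (B + norm x) / norm d" if "r \<in> T" for r
  proof -
    have "r * norm d = norm ((x + r *\<^sub>R d) - x)" using that by (simp add: T_def)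
    also have "\<dots> \<le> norm (x + r *\<^sub>R d) + norm x" by (rule norm_triangle_ineq4)
    also have "\<dots> \<le> B + norm x" using that B by (simp add: T_def)
    finally show ?thesis using \<open>d \<noteq> 0\<close> by (simp add: field_simps)
  qed
  then have "T \<subseteq> {0..(B + norm x) / norm d}" by (auto simp: T_def)
  then have "bounded T" using bounded_closed_interval bounded_subset by blast
  moreover have "closed T"
  proof -
    have "T = {0..} \<inter> (\<lambda>r. x + r *\<^sub>R d) -` S" by (auto simp: T_def)
    moreover have "closed ((\<lambda>r. x + r *\<^sub>R d) -` S)"
      by (intro closed_vimage \<open>closed S\<close> continuous_intros)
    ultimately show ?thesis by auto
  qed
  ultimately have "compact T" by (simp add: compact_eq_bounded_closed)
  moreover have "T \<noteq> {}" using \<open>x \<in> S\<close> by (auto simp: T_def intro: exI[of _ 0])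
  ultimately obtain s where "s \<in> T" "\<forall>r\<in>T. r \<le> s" by (metis compact_attains_sup)
  then show ?thesis
    by (intro that[of s]) (auto simp: T_def, metis linear order_trans)
qed

text \<open>
  At an extreme point \<open>x\<close> of a hyperplane slice, all segments of \<open>T\<close> centred at \<open>x\<close> lie on one
  line: two independent directions would combine to one inside the hyperplane. A segment of \<open>T\<close>
  centred at the last point of that line shrinks, towards \<open>x - d\<close>, to a parallel segment centred
  at \<open>x\<close>. So it lies on the line as well, and it would run past the last point.
\<close>

lemma line_end_extreme_point_of:
  fixes x d :: "'a::real_vector" and l :: "'a \<Rightarrow> real"
  assumes "convex T" "linear l" and x: "x extreme_point_of {z \<in> T. l z = c}"
    and d: "x + d \<in> T" "x - d \<in> T" "l d \<noteq> 0"
    and s: "0 \<le> s" "x + s *\<^sub>R d \<in> T" "\<And>r. x + r *\<^sub>R d \<in> T \<Longrightarrow> r \<le> s"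
  shows "(x + s *\<^sub>R d) extreme_point_of T"
proof (rule extreme_point_ofI_no_segment[OF \<open>convex T\<close> s(2)])
  interpret l: linear l by fact
  fix e assume e: "x + s *\<^sub>R d + e \<in> T" "x + s *\<^sub>R d - e \<in> T"
  define e' where "e' = (1 / (1 + s)) *\<^sub>R e"
  have weights: "1 / (1 + s) + s / (1 + s) = 1"
    using s(1) by (simp add: add_divide_distrib[symmetric])
  have e_eq: "e = (1 + s) *\<^sub>R e'" using s(1) by (simp add: e'_def)
  have e': "x + e' \<in> T" "x - e' \<in> T"
  proof -
    have shrink: "x + (1 / (1 + s)) *\<^sub>R u \<in> T" if "x + s *\<^sub>R d + u \<in> T" for u
    proof -
      have "(1 / (1 + s)) *\<^sub>R (x + s *\<^sub>R d + u) + (s / (1 + s)) *\<^sub>R (x - d) \<in> T"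
        using that d s weights \<open>convex T\<close> by (intro convexD) auto
      also have "(1 / (1 + s)) *\<^sub>R (x + s *\<^sub>R d + u) + (s / (1 + s)) *\<^sub>R (x - d)
          = (1 / (1 + s) + s / (1 + s)) *\<^sub>R x + (1 / (1 + s)) *\<^sub>R u"
        by (simp add: algebra_simps)
      finally show ?thesis by (simp add: weights)
    qed
    show "x + e' \<in> T" "x - e' \<in> T"
      using shrink[of e] shrink[of "- e"] e by (simp_all add: e'_def)
  qed
  \<comment> \<open>\<open>f\<close> is a multiple of the component of \<open>e'\<close> along the kernel of \<open>l\<close>, scaled to keep both ends in \<open>T\<close>.\<close>
  define q where "q = l e' / l d"
  define w where "w = 1 / (1 + \<bar>q\<bar>)"
  define f where "f = w *\<^sub>R (e' - q *\<^sub>R d)"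
  have w: "0 < w" "w + w * \<bar>q\<bar> = 1"
  proof -
    have "1 + \<bar>q\<bar> > 0" by linarith
    then show "0 < w" "w + w * \<bar>q\<bar> = 1" unfolding w_def by (auto simp: field_simps)
  qed
  have mix: "x + w *\<^sub>R (u - q *\<^sub>R v) \<in> T"
    if "x + u \<in> T" "x + v \<in> T" "x - v \<in> T" for u v
  proof -
    have "x - sgn q *\<^sub>R v \<in> T \<or> q = 0" using that by (cases "q > 0"; cases "q = 0") auto
    then have "w *\<^sub>R (x + u) + (w * \<bar>q\<bar>) *\<^sub>R (x - sgn q *\<^sub>R v) \<in> T"
    proof
      assume "x - sgn q *\<^sub>R v \<in> T"
      then show ?thesis using that w \<open>convex T\<close> by (intro convexD) auto
    next
      assume "q = 0"
      then show ?thesis using that w by simp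
    qed
    also have "w *\<^sub>R (x + u) + (w * \<bar>q\<bar>) *\<^sub>R (x - sgn q *\<^sub>R v)
       = (w + w * \<bar>q\<bar>) *\<^sub>R x + w *\<^sub>R u - (w * (\<bar>q\<bar> * sgn q)) *\<^sub>R v"
      by (simp add: algebra_simps)
    also have "\<dots> = x + w *\<^sub>R (u - q *\<^sub>R v)"
      unfolding w(2) abs_mult_sgn by (simp add: algebra_simps)
    finally show ?thesis .
  qed
  have "l f = 0" using d(3) by (simp add: f_def l.scale l.diff q_def)
  have "x + f \<in> T" using mix[of e' d] e' d by (simp add: f_def)
  moreover have "x - f \<in> T"
  proof -
    have "x + w *\<^sub>R (- e' - q *\<^sub>R (- d)) \<in> T" using mix[of "- e'" "- d"] e' d by simp
    then show ?thesis by (simp add: f_def algebra_simps)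
  qed
  moreover have "l x = c" using x by (simp add: extreme_point_of_def)
  ultimately have "f = 0"
    using \<open>l f = 0\<close> by (intro extreme_point_of_no_segment[OF x]) (auto simp: l.add l.diff)
  then have "e' = q *\<^sub>R d" using w(1) by (simp add: f_def)
  then have e_d: "e = ((1 + s) * q) *\<^sub>R d" by (simp add: e_eq)
  have "s + (1 + s) * q \<le> s" "s - (1 + s) * q \<le> s"
    using e s(3)[of "s + (1 + s) * q"] s(3)[of "s - (1 + s) * q"]
    by (simp_all add: e_d algebra_simps)
  then have "(1 + s) * q = 0" by linarith
  then show "e = 0" by (simp add: e_d)
qed

text \<open>
  Unless \<open>x\<close> is already extreme in \<open>T\<close>, a line through \<open>x\<close> meets \<open>T\<close> on both sides of \<open>x\<close>, and the
  two ends of \<open>T\<close> along it are extreme in \<open>T\<close>.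
\<close>

lemma extreme_point_of_hyperplane_slice_in_hull:
  fixes T :: "'a::real_normed_vector set" and l :: "'a \<Rightarrow> real"
  assumes T: "convex T" "closed T" "bounded T" and l: "linear l"
    and x: "x extreme_point_of {z \<in> T. l z = c}"
  shows "x \<in> convex hull {z. z extreme_point_of T}"
proof (cases "x extreme_point_of T")
  case True
  then show ?thesis by (simp add: hull_inc)
next
  case False
  interpret l: linear l by fact
  have "x \<in> T" "l x = c" using x by (auto simp: extreme_point_of_def)
  then obtain d where d: "x + d \<in> T" "x - d \<in> T" "d \<noteq> 0"
    using False extreme_point_ofI_no_segment[OF T(1)] by blast
  have "l d \<noteq> 0"
  proof
    assume "l d = 0"
    then have "d = 0"
      using d \<open>l x = c\<close> by (intro extreme_point_of_no_segment[OF x]) (auto simp: l.add l.diff)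
    with d show False by simp
  qed
  obtain s where s: "0 \<le> s" "x + s *\<^sub>R d \<in> T" "\<And>r. x + r *\<^sub>R d \<in> T \<Longrightarrow> r \<le> s"
    using last_point_of_ray[OF T(2,3) \<open>x \<in> T\<close> d(3)] by blast
  obtain r where r: "0 \<le> r" "x + r *\<^sub>R (- d) \<in> T" "\<And>q. x + q *\<^sub>R (- d) \<in> T \<Longrightarrow> q \<le> r"
    using last_point_of_ray[OF T(2,3) \<open>x \<in> T\<close>, of "- d"] d(3) by auto
  have "s \<ge> 1" using s(3)[of 1] d by simp
  have "(x + s *\<^sub>R d) extreme_point_of T"
    by (rule line_end_extreme_point_of[OF T(1) l x d(1,2) \<open>l d \<noteq> 0\<close> s])
  moreover have "(x + r *\<^sub>R (- d)) extreme_point_of T"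
    using d \<open>l d \<noteq> 0\<close>
    by (intro line_end_extreme_point_of[OF T(1) l x _ _ _ r]) (auto simp: l.neg)
  moreover have "x = (r / (r + s)) *\<^sub>R (x + s *\<^sub>R d) + (s / (r + s)) *\<^sub>R (x + r *\<^sub>R (- d))"
  proof -
    have "(r / (r + s)) *\<^sub>R (x + s *\<^sub>R d) + (s / (r + s)) *\<^sub>R (x + r *\<^sub>R (- d))
      = (r / (r + s) + s / (r + s)) *\<^sub>R x"
      by (simp add: algebra_simps)
    also have "r / (r + s) + s / (r + s) = 1"
      using \<open>s \<ge> 1\<close> r(1) by (simp add: add_divide_distrib[symmetric])
    finally show ?thesis by simp
  qed
  moreover have "r / (r + s) + s / (r + s) = 1"
    using \<open>s \<ge> 1\<close> r(1) by (simp add: add_divide_distrib[symmetric])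
  ultimately show ?thesis
    using convexD[OF convex_convex_hull, of "x + s *\<^sub>R d" "{z. z extreme_point_of T}"
        "x + r *\<^sub>R (- d)" "r / (r + s)" "s / (r + s)"] r(1) s(1)
    by (simp add: hull_inc)
qed

text \<open>
  A form of Dubins' theorem. Imposing the functionals one at a time reduces the claim to lines, and
  along a line the closed bounded set \<open>S\<close> has end points whatever the dimension of the space.
\<close>

lemma extreme_point_of_finite_slice_in_hull:
  fixes S :: "'a::real_normed_vector set" and l :: "nat \<Rightarrow> 'a \<Rightarrow> real"
  assumes S: "convex S" "closed S" "bounded S" and l: "\<And>i. bounded_linear (l i)"
    and "x extreme_point_of {z \<in> S. \<forall>i<n. l i z = c i}"
  shows "x \<in> convex hull {z. z extreme_point_of S}"
  using assms(5)
proof (induction n arbitrary: x)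
  case 0
  then show ?case by (simp add: hull_inc)
next
  case (Suc n)
  define T where "T = {z \<in> S. \<forall>i<n. l i z = c i}"
  have T_eq: "T = S \<inter> (\<Inter>i\<in>{..<n}. l i -` {c i})" by (auto simp: T_def)
  have lin: "linear (l i)" for i using l by (rule bounded_linear.linear)
  have "convex T" unfolding T_eq
    by (intro convex_Int S convex_INT convex_linear_vimage lin) auto
  moreover have "closed T" unfolding T_eq
    by (intro closed_Int S closed_INT ballI closed_vimage closed_singleton
        linear_continuous_on l)
  moreover have "bounded T" using S(3) by (rule bounded_subset) (auto simp: T_def)
  moreover have "{z \<in> S. \<forall>i<Suc n. l i z = c i} = {z \<in> T. l n z = c n}"
    by (auto simp: T_def less_Suc_eq)
  ultimately have "x \<in> convex hull {z. z extreme_point_of T}"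
    using Suc.prems lin by (intro extreme_point_of_hyperplane_slice_in_hull) auto
  moreover have "convex hull {z. z extreme_point_of T} \<subseteq> convex hull {z. z extreme_point_of S}"
    using Suc.IH by (intro hull_minimal) (auto simp: T_def)
  ultimately show ?case by blast
qed

section \<open>Minimum norm interpolation\<close>

lemma predual_norm: "predual P \<Longrightarrow> norm (P f) = norm f"
  by (simp add: predual_def isometric_iso_onto_def)

lemma predual_bounded_linear:
  assumes "predual P"
  shows "bounded_linear (\<lambda>f. blinfun_apply (P f) \<mu>)"
proof -
  have "linear P" using assms by (simp add: predual_def isometric_iso_onto_def)
  then have "bounded_linear P"
    by (intro bounded_linear_intro[of _ 1])
      (auto simp: linear_add linear_cmul predual_norm[OF assms])
  then show ?thesis
    by (intro bounded_linear_compose[OF blinfun.bounded_linear_left])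
qed

lemma predual_pairing_le:
  assumes "predual P"
  shows "blinfun_apply (P f) \<mu> \<le> norm f * norm \<mu>"
  using norm_blinfun[of "P f" \<mu>] by (simp add: predual_norm[OF assms])

text \<open>Testing the subgradient inequality at \<open>0\<close> and at \<open>2 \<mu>\<close> gives equality in the pairing.\<close>

lemma norm_subdifferential_iff:
  assumes "predual P"
  shows "f \<in> norm_subdifferential P \<mu> \<longleftrightarrow> norm f \<le> 1 \<and> blinfun_apply (P f) \<mu> = norm \<mu>"
proof
  assume "f \<in> norm_subdifferential P \<mu>"
  then have sub: "blinfun_apply (P f) (z - \<mu>) \<le> norm z - norm \<mu>" for z
    by (simp add: norm_subdifferential_def subdifferential_def)
  have "norm (2 *\<^sub>R \<mu>) = 2 * norm \<mu>" by simp
  then have "blinfun_apply (P f) \<mu> = norm \<mu>"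
    using sub[of 0] sub[of "2 *\<^sub>R \<mu>"]
    by (simp add: blinfun.minus_right scaleR_2 del: norm_scaleR)
  moreover have *: "blinfun_apply (P f) h \<le> norm h" for h
    using sub[of "\<mu> + h"] norm_triangle_ineq[of \<mu> h] by simp
  have "norm (P f) \<le> 1"
  proof (rule norm_blinfun_bound)
    fix h show "norm (blinfun_apply (P f) h) \<le> 1 * norm h"
      using *[of h] *[of "- h"] by (simp add: blinfun.minus_right abs_le_iff)
  qed simp
  ultimately show "norm f \<le> 1 \<and> blinfun_apply (P f) \<mu> = norm \<mu>"
    by (simp add: predual_norm[OF assms])
next
  assume f: "norm f \<le> 1 \<and> blinfun_apply (P f) \<mu> = norm \<mu>"
  have "blinfun_apply (P f) z \<le> norm z" for z
    using predual_pairing_le[OF assms, of f z] f mult_right_mono[of "norm f" 1 "norm z"]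
    by simp
  then show "f \<in> norm_subdifferential P \<mu>"
    using f by (simp add: norm_subdifferential_def subdifferential_def blinfun.diff_right)
qed

lemma norm_subdifferential_geometry:
  assumes "predual P"
  shows "convex (norm_subdifferential P \<mu>)" "closed (norm_subdifferential P \<mu>)"
    "bounded (norm_subdifferential P \<mu>)"
proof -
  note bl = predual_bounded_linear[OF assms, of \<mu>]
  have eq: "norm_subdifferential P \<mu> = cball 0 1 \<inter> (\<lambda>f. blinfun_apply (P f) \<mu>) -` {norm \<mu>}"
    by (auto simp: norm_subdifferential_iff[OF assms])
  show "convex (norm_subdifferential P \<mu>)" unfolding eq
    by (intro convex_Int convex_cball convex_linear_vimage bounded_linear.linear[OF bl]) auto
  show "closed (norm_subdifferential P \<mu>)" unfolding eq
    by (intro closed_Int closed_cball closed_vimage closed_singleton linear_continuous_on bl)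
  show "bounded (norm_subdifferential P \<mu>)" unfolding eq
    by (intro bounded_Int) auto
qed

lemma min_norm_interpolants_iff:
  "f \<in> min_norm_interpolants P n \<nu> y \<longleftrightarrow>
     f \<in> interpolants P n \<nu> y \<and> (\<forall>h\<in>interpolants P n \<nu> y. norm f \<le> norm h)"
proof -
  have "bdd_below (norm ` interpolants P n \<nu> y)" by (rule bdd_belowI[of _ 0]) auto
  then have "norm f = (INF h\<in>interpolants P n \<nu> y. norm h) \<longleftrightarrow>
      (\<forall>h\<in>interpolants P n \<nu> y. norm f \<le> norm h)" if "f \<in> interpolants P n \<nu> y"
    using that by (auto intro!: antisym cINF_greatest cINF_lower)
  then show ?thesis by (auto simp: min_norm_interpolants_def)
qed

text \<open>
  The pairing with the dual certificate \<open>\<mu>\<close> is constant on the interpolants, because \<open>\<mu>\<close> lies in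
  the span of the \<open>\<nu> i\<close>. The constant is the square of the norm of \<open>\<mu>\<close>, so no interpolant has norm
  below that of \<open>\<mu>\<close>, and equality singles out those that are scaled subgradients.
\<close>

lemma min_norm_interpolants_eq:
  assumes P: "predual P" and span: "\<mu> \<in> span (\<nu> ` {..<n})" and "\<mu> \<noteq> 0"
    and dual: "(\<lambda>f. norm \<mu> *\<^sub>R f) ` norm_subdifferential P \<mu> \<inter> interpolants P n \<nu> y \<noteq> {}"
  shows "min_norm_interpolants P n \<nu> y
    = (\<lambda>f. norm \<mu> *\<^sub>R f) ` norm_subdifferential P \<mu> \<inter> interpolants P n \<nu> y"
    and "f \<in> min_norm_interpolants P n \<nu> y \<Longrightarrow> norm f = norm \<mu>"
proof -
  have scaled: "f \<in> (\<lambda>f. norm \<mu> *\<^sub>R f) ` norm_subdifferential P \<mu> \<longleftrightarrow>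
      norm f \<le> norm \<mu> \<and> blinfun_apply (P f) \<mu> = norm \<mu> * norm \<mu>" for f
  proof -
    have "f \<in> (\<lambda>f. norm \<mu> *\<^sub>R f) ` norm_subdifferential P \<mu> \<longleftrightarrow>
        f /\<^sub>R norm \<mu> \<in> norm_subdifferential P \<mu>"
      using \<open>\<mu> \<noteq> 0\<close> by (auto simp: image_iff intro!: bexI[of _ "f /\<^sub>R norm \<mu>"])
    moreover have "blinfun_apply (P (f /\<^sub>R norm \<mu>)) \<mu> = blinfun_apply (P f) \<mu> / norm \<mu>"
      using linear_cmul[OF bounded_linear.linear[OF predual_bounded_linear[OF P, of \<mu>]],
          of "inverse (norm \<mu>)" f]
      by (simp add: divide_inverse mult.commute)
    moreover have "norm (f /\<^sub>R norm \<mu>) = norm f / norm \<mu>"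
      by (simp add: divide_inverse mult.commute)
    ultimately show ?thesis
      using \<open>\<mu> \<noteq> 0\<close> 
      by (simp only: norm_subdifferential_iff[OF P]) (simp add: divide_le_eq divide_eq_eq)
  qed
  obtain g where g: "g \<in> interpolants P n \<nu> y" "norm g \<le> norm \<mu>"
    "blinfun_apply (P g) \<mu> = norm \<mu> * norm \<mu>"
    using dual scaled by blast
  have const: "blinfun_apply (P h) \<mu> = norm \<mu> * norm \<mu>" if "h \<in> interpolants P n \<nu> y" for h
  proof -
    have "blinfun_apply (P h) z = blinfun_apply (P g) z" if "z \<in> \<nu> ` {..<n}" for z
      using that \<open>h \<in> _\<close> g(1) by (auto simp: interpolants_def)
    then have "blinfun_apply (P h) \<mu> = blinfun_apply (P g) \<mu>"
      by (rule linear_eq_on_span[OF bounded_linear.linear[OF blinfun.bounded_linear_right]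
            bounded_linear.linear[OF blinfun.bounded_linear_right] _ span])
    then show ?thesis using g(3) by simp
  qed
  have lower: "norm \<mu> \<le> norm h" if "h \<in> interpolants P n \<nu> y" for h
    using predual_pairing_le[OF P, of h \<mu>] const[OF that] \<open>\<mu> \<noteq> 0\<close> by simp
  show "min_norm_interpolants P n \<nu> y
    = (\<lambda>f. norm \<mu> *\<^sub>R f) ` norm_subdifferential P \<mu> \<inter> interpolants P n \<nu> y"
    using g const lower unfolding set_eq_iff Int_iff scaled min_norm_interpolants_iff
    by (metis order_trans)
  show "norm f = norm \<mu>" if "f \<in> min_norm_interpolants P n \<nu> y"
    using that g lower unfolding min_norm_interpolants_iff by (metis order_trans order_antisym)
qed

text \<open>
  Divided by the norm of \<open>\<mu>\<close>, the minimum norm interpolants become the slice of the subdifferential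
  by the functionals \<open>\<nu> i\<close>, and Dubins' theorem applies to it.
\<close>

lemma extreme_min_norm_interpolant_in_span:
  assumes P: "predual P" and span: "\<mu> \<in> span (\<nu> ` {..<n})" and "\<mu> \<noteq> 0"
    and dual: "(\<lambda>f. norm \<mu> *\<^sub>R f) ` norm_subdifferential P \<mu> \<inter> interpolants P n \<nu> y \<noteq> {}"
    and f: "f extreme_point_of min_norm_interpolants P n \<nu> y"
  shows "f \<in> span (extreme_points (norm_subdifferential P \<mu>))"
proof -
  let ?F = "norm_subdifferential P \<mu>"
  let ?G = "{z \<in> ?F. \<forall>i<n. blinfun_apply (P z) (\<nu> i) = y i / norm \<mu>}"
  have image: "min_norm_interpolants P n \<nu> y = (\<lambda>z. norm \<mu> *\<^sub>R z) ` ?G"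
  proof -
    have "norm \<mu> *\<^sub>R z \<in> interpolants P n \<nu> y \<longleftrightarrow>
        (\<forall>i<n. blinfun_apply (P z) (\<nu> i) = y i / norm \<mu>)" for z
      using linear_cmul[OF bounded_linear.linear[OF predual_bounded_linear[OF P]], of "norm \<mu>" z]
        \<open>\<mu> \<noteq> 0\<close>
      by (simp add: interpolants_def field_simps)
    then show ?thesis
      unfolding min_norm_interpolants_eq(1)[OF P span \<open>\<mu> \<noteq> 0\<close> dual] by auto
  qed
  obtain z where z: "f = norm \<mu> *\<^sub>R z"
    using \<open>\<mu> \<noteq> 0\<close> that[of "f /\<^sub>R norm \<mu>"] by simp
  have "norm \<mu> *\<^sub>R z extreme_point_of (\<lambda>z. norm \<mu> *\<^sub>R z) ` ?G"
    using f unfolding image z .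
  then have "z extreme_point_of ?G"
    by (rule extreme_point_of_linear_imageD[rotated 2])
      (use \<open>\<mu> \<noteq> 0\<close> in \<open>simp_all add: inj_on_def\<close>)
  have "z \<in> convex hull {z. z extreme_point_of ?F}"
    by (rule extreme_point_of_finite_slice_in_hull[OF norm_subdifferential_geometry[OF P]
          predual_bounded_linear[OF P] \<open>z extreme_point_of ?G\<close>])
  then have "z \<in> span (extreme_points ?F)"
    using convex_hull_subset_span by (auto simp: extreme_points_def)
  then show ?thesis unfolding z by (rule span_scale)
qed

section \<open>Sparsity\<close>

text \<open>
  If the norm is a multiple of the \<open>\<ell>\<^sup>1\<close> norm of the coefficients, a small perturbation supported
  where \<open>\<alpha>\<close> does not vanish reverses no sign, so adding and subtracting it gives two norms with
  mean \<open>norm f\<close>. If it preserves the interpolation conditions, neither norm can be below the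
  minimum; both elements are then minimal, which extremality forbids unless the perturbation is 0.
\<close>

lemma extreme_min_norm_support_independent:
  fixes g :: "nat \<Rightarrow> 'b::banach"
  assumes P: "predual P" and "C > 0"
    and norm_l1: "\<And>\<beta>. norm (\<Sum>j<m. \<beta> j *\<^sub>R g j) = C * (\<Sum>j<m. \<bar>\<beta> j\<bar>)"
    and f: "f extreme_point_of min_norm_interpolants P n \<nu> y" "f = (\<Sum>j<m. \<alpha> j *\<^sub>R g j)"
    and kernel: "\<And>i. i < n \<Longrightarrow> (\<Sum>j | j < m \<and> \<alpha> j \<noteq> 0. \<beta> j * blinfun_apply (P (g j)) (\<nu> i)) = 0"
    and j: "j < m" "\<alpha> j \<noteq> 0"
  shows "\<beta> j = 0"
proof -
  define b where "b j = (if \<alpha> j \<noteq> 0 then \<beta> j else 0)" for j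
  define d where "d = (\<Sum>j<m. b j *\<^sub>R g j)"
  have "\<exists>e>0. \<forall>j<k. e * \<bar>b j\<bar> \<le> \<bar>\<alpha> j\<bar>" for k
  proof (induction k)
    case 0
    show ?case by (intro exI[of _ 1]) auto
  next
    case (Suc k)
    then obtain e where e: "e > 0" "\<forall>j<k. e * \<bar>b j\<bar> \<le> \<bar>\<alpha> j\<bar>" by blast
    show ?case
    proof (cases "b k = 0")
      case True
      then show ?thesis using e by (intro exI[of _ e]) (auto simp: less_Suc_eq)
    next
      case False
      then have "\<alpha> k \<noteq> 0" by (auto simp: b_def split: if_splits)
      define e' where "e' = min e (\<bar>\<alpha> k\<bar> / \<bar>b k\<bar>)"
      have "e' > 0" "e' \<le> e" "e' * \<bar>b k\<bar> \<le> \<bar>\<alpha> k\<bar>"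
        using e False \<open>\<alpha> k \<noteq> 0\<close> by (auto simp: e'_def min_def field_simps)
      moreover have "e' * \<bar>b j\<bar> \<le> e * \<bar>b j\<bar>" for j
        using \<open>e' \<le> e\<close> by (intro mult_right_mono) auto
      ultimately show ?thesis
        using e by (intro exI[of _ e']) (auto simp: less_Suc_eq intro: order_trans)
    qed
  qed
  then obtain e where e: "e > 0" "\<And>j. j < m \<Longrightarrow> e * \<bar>b j\<bar> \<le> \<bar>\<alpha> j\<bar>" by blast
  interpret P: bounded_linear "\<lambda>f. blinfun_apply (P f) (\<nu> i)" for i
    by (rule predual_bounded_linear[OF P])
  have f_min: "f \<in> min_norm_interpolants P n \<nu> y"
    using f(1) by (simp add: extreme_point_of_def)
  have "blinfun_apply (P d) (\<nu> i) = 0" if "i < n" for i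
  proof -
    have "blinfun_apply (P d) (\<nu> i) = (\<Sum>j<m. b j * blinfun_apply (P (g j)) (\<nu> i))"
      by (simp add: d_def P.sum P.scaleR)
    also have "\<dots> = (\<Sum>j | j < m \<and> \<alpha> j \<noteq> 0. \<beta> j * blinfun_apply (P (g j)) (\<nu> i))"
      by (intro sum.mono_neutral_cong_right) (auto simp: b_def)
    finally show ?thesis using kernel[OF that] by simp
  qed
  then have interp: "f + e *\<^sub>R d \<in> interpolants P n \<nu> y" "f - e *\<^sub>R d \<in> interpolants P n \<nu> y"
    using f_min by (auto simp: min_norm_interpolants_iff interpolants_def P.add P.diff P.scaleR)
  have plus: "f + e *\<^sub>R d = (\<Sum>j<m. (\<alpha> j + e * b j) *\<^sub>R g j)"
    by (simp add: f(2) d_def scaleR_sum_right scaleR_add_left sum.distrib)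
  have minus: "f - e *\<^sub>R d = (\<Sum>j<m. (\<alpha> j - e * b j) *\<^sub>R g j)"
    by (simp add: f(2) d_def scaleR_sum_right scaleR_diff_left sum_subtractf)
  have "\<bar>\<alpha> j + e * b j\<bar> + \<bar>\<alpha> j - e * b j\<bar> = 2 * \<bar>\<alpha> j\<bar>" if "j < m" for j
  proof -
    have "\<bar>e * b j\<bar> \<le> \<bar>\<alpha> j\<bar>" using e that by (simp add: abs_mult)
    then show ?thesis by linarith
  qed
  then have "(\<Sum>j<m. \<bar>\<alpha> j + e * b j\<bar>) + (\<Sum>j<m. \<bar>\<alpha> j - e * b j\<bar>) = 2 * (\<Sum>j<m. \<bar>\<alpha> j\<bar>)"
    unfolding sum.distrib[symmetric] sum_distrib_left by (intro sum.cong) auto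
  then have "norm (f + e *\<^sub>R d) + norm (f - e *\<^sub>R d) = 2 * norm f"
    unfolding plus minus unfolding norm_l1 f(2) by (simp add: algebra_simps flip: distrib_left)
  moreover have "norm f \<le> norm (f + e *\<^sub>R d)" "norm f \<le> norm (f - e *\<^sub>R d)"
    using f_min interp by (auto simp: min_norm_interpolants_iff)
  ultimately have "norm (f + e *\<^sub>R d) = norm f" "norm (f - e *\<^sub>R d) = norm f" by linarith+
  then have "e *\<^sub>R d = 0"
    using f_min interp
    by (intro extreme_point_of_no_segment[OF f(1)]) (simp_all add: min_norm_interpolants_iff)
  then have "norm d = 0" using e by simp
  then have "(\<Sum>j<m. \<bar>b j\<bar>) = 0" using norm_l1[of b] \<open>C > 0\<close> by (simp add: d_def)
  then have "b j = 0" using j(1) by (simp add: sum_nonneg_eq_0_iff)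
  then show ?thesis using j(2) by (simp add: b_def)
qed

text \<open>
  Independence is assumed of the family of columns, so repeated columns are excluded and the
  number of indices counts distinct vectors.
\<close>

lemma (in vec_space) card_independent_columns_le_rank:
  assumes A: "A \<in> carrier_mat n m" and S: "S \<subseteq> {..<m}"
    and indep: "\<And>\<beta> j. (\<And>i. i < n \<Longrightarrow> (\<Sum>j\<in>S. \<beta> j * A $$ (i, j)) = 0) \<Longrightarrow> j \<in> S \<Longrightarrow> \<beta> j = 0"
  shows "card S \<le> rank A"
proof -
  have fin: "finite S" using S finite_subset by blast
  have entry: "col A j $ i = A $$ (i, j)" if "j \<in> S" "i < n" for i j
    using that A S by auto
  have inj: "inj_on (col A) S"
  proof (rule inj_onI, rule ccontr)
    fix j k assume jk: "j \<in> S" "k \<in> S" "col A j = col A k" "j \<noteq> k"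
    define \<beta> :: "nat \<Rightarrow> 'a" where "\<beta> i = (if i = j then 1 else if i = k then - 1 else 0)" for i
    have "(\<Sum>h\<in>S. \<beta> h * A $$ (i, h)) = 0" if "i < n" for i
    proof -
      have "(\<Sum>h\<in>S. \<beta> h * A $$ (i, h)) = (\<Sum>h\<in>{j, k}. \<beta> h * A $$ (i, h))"
        using fin jk by (intro sum.mono_neutral_right) (auto simp: \<beta>_def)
      also have "\<dots> = A $$ (i, j) - A $$ (i, k)" using jk by (simp add: \<beta>_def)
      also have "\<dots> = 0" using entry[OF jk(1) that] entry[OF jk(2) that] jk(3) by simp
      finally show ?thesis .
    qed
    from indep[OF this jk(1)] show False by (simp add: \<beta>_def)
  qed
  have cols: "col A ` S \<subseteq> carrier_vec n" using A by auto
  have "lin_indpt (col A ` S)"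
  proof (rule finite_lin_indpt2)
    show "finite (col A ` S)" using fin by simp
    show "col A ` S \<subseteq> carrier_vec n" by (rule cols)
    fix a assume zero: "lincomb a (col A ` S) = 0\<^sub>v n"
    have "(\<Sum>j\<in>S. a (col A j) * A $$ (i, j)) = 0" if "i < n" for i
    proof -
      have "0 = lincomb a (col A ` S) $ i" using zero that by simp
      also have "\<dots> = (\<Sum>v\<in>col A ` S. a v * v $ i)" by (rule lincomb_index[OF that cols])
      also have "\<dots> = (\<Sum>j\<in>S. a (col A j) * A $$ (i, j))"
        using entry that by (simp add: sum.reindex[OF inj])
      finally show ?thesis by simp
    qed
    then have "a (col A j) = 0" if "j \<in> S" for j by (rule indep) (use that in auto)
    then show "\<forall>v\<in>col A ` S. a v = 0" by auto
  qed
  moreover have "col A ` S \<subseteq> set (cols A)" using A S by (auto simp: cols_def)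
  ultimately have "card (col A ` S) \<le> rank A" by (intro rank_ge_card_indpt[OF A])
  then show ?thesis by (simp add: card_image[OF inj])
qed

lemma span_image_lessThan_sum:
  fixes g :: "nat \<Rightarrow> 'a::real_vector"
  assumes "x \<in> span (g ` {..<m})"
  obtains \<alpha> where "x = (\<Sum>j<m. \<alpha> j *\<^sub>R g j)"
proof -
  have "\<exists>\<alpha>. x = (\<Sum>j<m. \<alpha> j *\<^sub>R g j)"
    using assms
  proof (induction rule: span_induct_alt)
    case base
    show ?case by (intro exI[of _ "\<lambda>_. 0"]) simp
  next
    case (step c z x)
    then obtain \<alpha> k where x: "x = (\<Sum>j<m. \<alpha> j *\<^sub>R g j)" and k: "k < m" "z = g k" by auto
    have "(\<Sum>j<m. (\<alpha> j + (if j = k then c else 0)) *\<^sub>R g j) = c *\<^sub>R z + x"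
      using k by (simp add: x scaleR_add_left sum.distrib if_distrib[of "\<lambda>c. c *\<^sub>R _"] cong: if_cong)
    then show ?case by metis
  qed
  then show thesis using that by blast
qed

theorem theorem10:
  fixes ev :: "'b::banach \<Rightarrow> 'x \<Rightarrow> real"
    and ev' :: "'d::banach \<Rightarrow> 'y \<Rightarrow> real"
    and J :: "'d \<Rightarrow> 'b \<Rightarrow>\<^sub>L real"
    and K :: "'x \<Rightarrow> 'y \<Rightarrow> real"
    and P :: "'b \<Rightarrow> 'p::banach \<Rightarrow>\<^sub>L real"
    and n :: nat
    and \<nu> :: "nat \<Rightarrow> 'p"
    and y :: "nat \<Rightarrow> real"
    and \<nu>h :: 'p
    and X\<^sub>f :: "'p \<Rightarrow> 'y set"
    and t :: "nat \<Rightarrow> 'y"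
    and C :: real
    and fh :: 'b
  assumes pair: "rkbs_pair ev ev' J K"
    and predual: "predual P"
    and indep: "inj_on \<nu> {..<n}" "independent (\<nu> ` {..<n})"
    and y_nonzero: "\<exists>j<n. y j \<noteq> 0"
    and \<nu>h_span: "\<nu>h \<in> span (\<nu> ` {..<n})"
    and \<nu>h_dual:
      "(\<lambda>f. norm \<nu>h *\<^sub>R f) ` norm_subdifferential P \<nu>h \<inter> interpolants P n \<nu> y \<noteq> {}"
    and A1: "assumption_A1 ev K P (span (\<nu> ` {..<n})) X\<^sub>f"
    and enum: "bij_betw t {..<card (X\<^sub>f \<nu>h)} (X\<^sub>f \<nu>h)"
    and C_pos: "C > 0"
    and A2: "assumption_A2 ev K C"
    and fh_ext: "fh \<in> extreme_points (min_norm_interpolants P n \<nu> y)"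
  shows "\<exists>(M::nat) (\<alpha>::nat \<Rightarrow> real) (x'::nat \<Rightarrow> 'y).
           0 < M \<and> M \<le> vec_space.rank n (L_matrix ev K P n \<nu> (card (X\<^sub>f \<nu>h)) t) \<and>
           (\<forall>j<M. \<alpha> j \<noteq> 0) \<and>
           (\<Sum>j<M. \<bar>\<alpha> j\<bar>) = norm \<nu>h / C \<and>
           (\<forall>j<M. x' j \<in> X\<^sub>f \<nu>h) \<and>
           fh = (\<Sum>j<M. \<alpha> j *\<^sub>R kernel_section ev K (x' j))"
proof -
  define m where "m = card (X\<^sub>f \<nu>h)"
  define g where "g = (\<lambda>j. kernel_section ev K (t j))"
  have inj_t: "inj_on t {..<m}" and image_t: "t ` {..<m} = X\<^sub>f \<nu>h"
    using enum by (auto simp: bij_betw_def m_def)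
  have norm_l1: "norm (\<Sum>j<m. \<beta> j *\<^sub>R g j) = C * (\<Sum>j<m. \<bar>\<beta> j\<bar>)" for \<beta>
    using A2 inj_t unfolding assumption_A2_def g_def by blast
  interpret P: bounded_linear "\<lambda>f. blinfun_apply (P f) \<mu>" for \<mu>
    by (rule predual_bounded_linear[OF predual])
  have zero_no_interpolant: "0 \<notin> interpolants P n \<nu> y"
    using y_nonzero by (auto simp: interpolants_def P.zero)
  then have "\<nu>h \<noteq> 0" using \<nu>h_dual by auto
  note dual = predual \<nu>h_span \<open>\<nu>h \<noteq> 0\<close> \<nu>h_dual
  have ext: "fh extreme_point_of min_norm_interpolants P n \<nu> y"
    using fh_ext by (simp add: extreme_points_def)
  then have fh_min: "fh \<in> min_norm_interpolants P n \<nu> y" by (simp add: extreme_point_of_def)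
  have "extreme_points (norm_subdifferential P \<nu>h) \<subseteq> span (g ` {..<m})"
  proof -
    have "extreme_points (norm_subdifferential P \<nu>h) \<subseteq> uminus ` g ` {..<m} \<union> g ` {..<m}"
    proof -
      have "extreme_points (norm_subdifferential P \<nu>h) \<subseteq>
          (\<lambda>x'. - kernel_section ev K x') ` X\<^sub>f \<nu>h \<union> kernel_section ev K ` X\<^sub>f \<nu>h"
        using A1 \<nu>h_span \<open>\<nu>h \<noteq> 0\<close> unfolding assumption_A1_def by (elim ballE[of _ _ \<nu>h]) simp_all
      then show ?thesis by (simp only: g_def image_image image_t[symmetric])
    qed
    also have "\<dots> \<subseteq> span (g ` {..<m})" by (blast intro: span_neg span_base)
    finally show ?thesis .
  qed
  then have "span (extreme_points (norm_subdifferential P \<nu>h)) \<subseteq> span (g ` {..<m})"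
    by (rule span_minimal) simp
  with extreme_min_norm_interpolant_in_span[OF dual ext]
  have "fh \<in> span (g ` {..<m})" by (rule subsetD[rotated])
  then obtain \<alpha> where fh: "fh = (\<Sum>j<m. \<alpha> j *\<^sub>R g j)"
    by (rule span_image_lessThan_sum)
  define S where "S = {j. j < m \<and> \<alpha> j \<noteq> 0}"
  have "finite S" by (simp add: S_def)
  have "fh = (\<Sum>j\<in>S. \<alpha> j *\<^sub>R g j)"
    unfolding fh S_def by (intro sum.mono_neutral_right) auto
  have "S \<noteq> {}"
    using zero_no_interpolant fh_min \<open>fh = (\<Sum>j\<in>S. \<alpha> j *\<^sub>R g j)\<close>
    by (auto simp: min_norm_interpolants_iff)
  have l1: "(\<Sum>j\<in>S. \<bar>\<alpha> j\<bar>) = norm \<nu>h / C"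
  proof -
    have "norm \<nu>h = C * (\<Sum>j<m. \<bar>\<alpha> j\<bar>)"
      using min_norm_interpolants_eq(2)[OF dual fh_min] norm_l1[of \<alpha>] by (simp add: fh)
    also have "(\<Sum>j<m. \<bar>\<alpha> j\<bar>) = (\<Sum>j\<in>S. \<bar>\<alpha> j\<bar>)"
      unfolding S_def by (intro sum.mono_neutral_right) auto
    finally show ?thesis using C_pos by simp
  qed
  have rank: "card S \<le> vec_space.rank n (L_matrix ev K P n \<nu> m t)"
  proof (rule vec_space.card_independent_columns_le_rank)
    show "L_matrix ev K P n \<nu> m t \<in> carrier_mat n m" by (simp add: L_matrix_def)
    show "S \<subseteq> {..<m}" by (auto simp: S_def)
    fix \<beta> j
    assume "j \<in> S"
      and zero: "\<And>i. i < n \<Longrightarrow> (\<Sum>j\<in>S. \<beta> j * L_matrix ev K P n \<nu> m t $$ (i, j)) = 0"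
    have "(\<Sum>j | j < m \<and> \<alpha> j \<noteq> 0. \<beta> j * blinfun_apply (P (g j)) (\<nu> i)) = 0" if "i < n" for i
    proof -
      have "(\<Sum>j | j < m \<and> \<alpha> j \<noteq> 0. \<beta> j * blinfun_apply (P (g j)) (\<nu> i))
          = (\<Sum>j\<in>S. \<beta> j * L_matrix ev K P n \<nu> m t $$ (i, j))"
        using that unfolding S_def by (intro sum.cong) (auto simp: L_matrix_def g_def)
      then show ?thesis using zero[OF that] by simp
    qed
    then show "\<beta> j = 0"
      by (rule extreme_min_norm_support_independent[OF predual C_pos norm_l1 ext fh])
        (use \<open>j \<in> S\<close> in \<open>simp_all add: S_def\<close>)
  qed
  obtain h where h: "bij_betw h {..<card S} S"
    using bij_betw_from_nat_into_finite[OF \<open>finite S\<close>] by blast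
  have h_S: "h j \<in> S" if "j < card S" for j using h that by (auto simp: bij_betw_def)
  show ?thesis
  proof (intro exI[of _ "card S"] exI[of _ "\<alpha> \<circ> h"] exI[of _ "t \<circ> h"] conjI allI impI)
    show "0 < card S" using \<open>finite S\<close> \<open>S \<noteq> {}\<close> by (simp add: card_gt_0_iff)
    show "card S \<le> vec_space.rank n (L_matrix ev K P n \<nu> (card (X\<^sub>f \<nu>h)) t)"
      using rank by (simp add: m_def)
    show "(\<alpha> \<circ> h) j \<noteq> 0" if "j < card S" for j using h_S[OF that] by (simp add: S_def)
    show "(\<Sum>j<card S. \<bar>(\<alpha> \<circ> h) j\<bar>) = norm \<nu>h / C"
      using l1 sum.reindex_bij_betw[OF h, of "\<lambda>j. \<bar>\<alpha> j\<bar>"] by simp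
    show "(t \<circ> h) j \<in> X\<^sub>f \<nu>h" if "j < card S" for j
      using h_S[OF that] image_t by (auto simp: S_def)
    show "fh = (\<Sum>j<card S. (\<alpha> \<circ> h) j *\<^sub>R kernel_section ev K ((t \<circ> h) j))"
      using \<open>fh = (\<Sum>j\<in>S. \<alpha> j *\<^sub>R g j)\<close> sum.reindex_bij_betw[OF h, of "\<lambda>j. \<alpha> j *\<^sub>R g j"]
      by (simp add: g_def)
  qed
qed

end
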